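(* Let $P\ge1$, $r_1,\dots,r_P\ge1$, $m_1,\dots,m_P\ge2$, $\eta_1,\eta_2,T\ge1$ be integers and $r=\sum_{p=1}^Pr_p\ge2$. The communication load of the hypercuboid coded distributed computing scheme with these parameters (Node Grouping 2, NG File Mapping, Function Assignment 2 and the NG Shuffle Method) is $$L_{\rm c}(m_1,\dots,m_P,r_1,\dots,r_P)=\frac1{r-1}\cdot\frac{r}{\sum_{p=1}^P\frac{r_pm_p}{m_p-1}}=\frac1{r-1}\cdot L_{\rm u}(m_1,\dots,m_P,r_1,\dots,r_P),$$ where $L_{\rm u}(m_1,\dots,m_P,r_1,\dots,r_P)$ is the communication load of the uncoded Shuffle phase for the same file placement and function assignment.
   Context: Model. There are $K$ nodes $[K]=\{1,\dots,K\}$, $N$ input files $w_1,\dots,w_N$ and $Q$ output (reduce) functions. For $i\in[Q]$, $j\in[N]$ there is an intermediate value (IV) $v_{i,j}\in\{0,1\}^T$, computed from file $w_j$ alone; function $i$ can be computed from $v_{i,1},\dots,v_{i,N}$. Node $k$ stores a set of files $\mathcal M_k$, computes all IVs $v_{i,j}$ with $i\in[Q]$, $w_j\in\mathcal M_k$, and must compute the functions in $\mathcal W_k\subseteq[Q]$. In the Shuffle phase nodes broadcast messages to each other over a shared link. The communication load is the total number of bits transmitted by all nodes in the Shuffle phase divided by $QNT$. Node Grouping 2. The node set $[K]$ is partitioned into $\mathcal C_1,\dots,\mathcal C_P$, and each $\mathcal C_p$ is partitioned into $r_p$ subsets of size $m_p$; so $K=\sum_pr_pm_p$. Altogether this gives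 $r=\sum_pr_p$ sets $\mathcal K_1,\dots,\mathcal K_r$ partitioning $[K]$ (those numbered $r_1+\dots+r_{p-1}+1,\dots,r_1+\dots+r_p$ partition $\mathcal C_p$). A node group is a set of $r$ nodes containing exactly one node from each $\mathcal K_i$, $i\in[r]$; there are $X=\prod_{p=1}^Pm_p^{r_p}$ node groups $\mathcal T_1,\dots,\mathcal T_X$; $\mathcal T_{j,i}$ denotes the unique node in $\mathcal T_j\cap\mathcal K_i$. NG File Mapping. $N=\eta_1X$; the files are partitioned into sets $\mathcal B_1,\dots,\mathcal B_X$ of size $\eta_1$, and $\mathcal M_k=\bigcup_{i:\,k\in\mathcal T_i}\mathcal B_i$. Function Assignment 2. Let $Y$ be the least common multiple of $m_1-1,\dots,m_P-1$. Then $Q=\eta_2Y\sum_{p=1}^P\frac{r_pm_p}{m_p-1}$, and $[Q]$ is partitioned into $\mathcal W_1,\dots,\mathcal W_K$ with $|\mathcal W_k|=\frac{\eta_2Y}{m_p-1}$ for $k\in\mathcal C_p$. NG Shuffle Method. For $\alpha\in[X]$ and $z\in\mathcal T_\alpha$ with $z\in\mathcal K_h$, let $$\mathcal L_{z,\alpha}=\{\ell\in[X]:\mathcal T_{\ell,h}\neq z,\ \mathcal T_{\ell,i}=\mathcal T_{\alpha,i}\ \forall i\in[r]\setminus\{h\}\},$$ $$\mathcal V^{\{z\}}_{\mathcal T_\alpha\setminus z}=\bigcup_{\ell\in\mathcal L_{z,\alpha}}\{v_{i,j}: i\in\mathcal W_z,\ w_j\in\mathcal B_\ell\}.$$ The IVs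 of $\mathcal V^{\{z\}}_{\mathcal T_\alpha\setminus z}$ are concatenated into one bit string, which is split into $r-1$ segments of equal length, denoted $\mathcal V^{\{z\},\sigma}_{\mathcal T_\alpha\setminus z}$ and indexed by $\sigma\in\mathcal T_\alpha\setminus\{z\}$ (it is assumed that $T$ is such that the bit length is divisible by $r-1$). For every $\alpha\in[X]$ and every $k\in\mathcal T_\alpha$, node $k$ multicasts the bitwise XOR $\bigoplus_{z\in\mathcal T_\alpha\setminus\{k\}}\mathcal V^{\{z\},k}_{\mathcal T_\alpha\setminus z}$ to the nodes of $\mathcal T_\alpha\setminus\{k\}$. Uncoded Shuffle phase. Every IV $v_{i,j}$ with $i\in\mathcal W_k$, $w_j\notin\mathcal M_k$ for some node $k$ is transmitted individually ($T$ bits) exactly once to the node $k$ requesting it. *)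

theory Defs
  imports Complex_Main "HOL-Library.Disjoint_Sets"
begin

definition indexed_partition :: "(nat \<Rightarrow> nat set) \<Rightarrow> nat set \<Rightarrow> nat set \<Rightarrow> bool" where
  "indexed_partition A I S \<longleftrightarrow> disjoint_family_on A I \<and> (\<Union>i\<in>I. A i) = S"


section \<open>Distributed computing model and communication load\<close>

text \<open>
  Nodes, files and functions are numbered from 1. The field \<open>iv S i j\<close> is the intermediate
  value of function \<open>i\<close> on file \<open>j\<close>. It is an arbitrary string of \<open>iv_len S\<close> bits, since the
  contents of the files and the map and reduce functions do not influence the load.
\<close>

record cdc =
  num_nodes :: nat
  num_files :: nat
  num_funs :: nat
  iv_len :: nat
  iv :: "nat \<Rightarrow> nat \<Rightarrow> bool list"
  stored :: "nat \<Rightarrow> nat set"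
  assigned :: "nat \<Rightarrow> nat set"

text \<open>
  The load of a Shuffle phase in which one message \<open>msg a\<close> is sent over the shared link
  for every \<open>a \<in> A\<close>; a multicast counts once, whatever the number of its receivers.
\<close>

definition comm_load :: "'b cdc_scheme \<Rightarrow> 'a set \<Rightarrow> ('a \<Rightarrow> bool list) \<Rightarrow> real" where
  "comm_load S A msg =
     real (\<Sum>a\<in>A. length (msg a)) / (real (num_funs S) * real (num_files S) * real (iv_len S))"

definition requests :: "'b cdc_scheme \<Rightarrow> (nat \<times> nat \<times> nat) set" where
  "requests S = {(k, i, j). k \<in> {1..num_nodes S} \<and> i \<in> assigned S k
                          \<and> j \<in> {1..num_files S} \<and> j \<notin> stored S k}"

definition uncoded_load :: "'b cdc_scheme \<Rightarrow> real" where
  "uncoded_load S = comm_load S (requests S) (\<lambda>(k, i, j). iv S i j)"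


section \<open>The hypercuboid scheme\<close>

text \<open>
  \<open>node_class\<close>, \<open>node_part\<close>, \<open>node_group\<close> and \<open>batch\<close> are the families of sets called
  C, K, T and B. The last two fields are the choices that the shuffle method leaves open:
  \<open>iv_order S z \<alpha>\<close> lists the pairs (function, file) of the intermediate values that \<open>z\<close> requests
  in group \<open>\<alpha>\<close>, in the order of concatenation, and \<open>seg_pos S z \<alpha> \<sigma>\<close> is the position
  (from 0) of the segment labelled by the node \<open>\<sigma>\<close>.
\<close>

record hypercuboid = cdc +
  node_class :: "nat \<Rightarrow> nat set"
  node_part :: "nat \<Rightarrow> nat set"
  node_group :: "nat \<Rightarrow> nat set"
  batch :: "nat \<Rightarrow> nat set"
  iv_order :: "nat \<Rightarrow> nat \<Rightarrow> (nat \<times> nat) list"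
  seg_pos :: "nat \<Rightarrow> nat \<Rightarrow> nat \<Rightarrow> nat"

definition group_size :: "nat \<Rightarrow> (nat \<Rightarrow> nat) \<Rightarrow> nat" where
  "group_size P r = (\<Sum>p=1..P. r p)"

definition num_groups :: "nat \<Rightarrow> (nat \<Rightarrow> nat) \<Rightarrow> (nat \<Rightarrow> nat) \<Rightarrow> nat" where
  "num_groups P r m = (\<Prod>p=1..P. m p ^ r p)"

definition part_indices :: "(nat \<Rightarrow> nat) \<Rightarrow> nat \<Rightarrow> nat set" where
  "part_indices r p = {(\<Sum>q\<in>{1..<p}. r q) + 1..(\<Sum>q\<in>{1..p}. r q)}"

definition lcm_pred :: "nat \<Rightarrow> (nat \<Rightarrow> nat) \<Rightarrow> nat" where
  "lcm_pred P m = Lcm ((\<lambda>p. m p - 1) ` {1..P})"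

definition all_node_groups :: "nat \<Rightarrow> (nat \<Rightarrow> nat) \<Rightarrow> 'b hypercuboid_scheme \<Rightarrow> nat set set" where
  "all_node_groups P r S =
     {G. G \<subseteq> {1..num_nodes S} \<and> card G = group_size P r \<and>
         (\<forall>i\<in>{1..group_size P r}. card (G \<inter> node_part S i) = 1)}"

definition node_grouping ::
  "nat \<Rightarrow> (nat \<Rightarrow> nat) \<Rightarrow> (nat \<Rightarrow> nat) \<Rightarrow> 'b hypercuboid_scheme \<Rightarrow> bool" where
  "node_grouping P r m S \<longleftrightarrow>
     num_nodes S = (\<Sum>p=1..P. r p * m p) \<and>
     indexed_partition (node_class S) {1..P} {1..num_nodes S} \<and>
     (\<forall>p\<in>{1..P}. indexed_partition (node_part S) (part_indices r p) (node_class S p) \<and>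
                 (\<forall>i\<in>part_indices r p. card (node_part S i) = m p)) \<and>
     bij_betw (node_group S) {1..num_groups P r m} (all_node_groups P r S)"

definition file_mapping ::
  "nat \<Rightarrow> (nat \<Rightarrow> nat) \<Rightarrow> (nat \<Rightarrow> nat) \<Rightarrow> nat \<Rightarrow> 'b hypercuboid_scheme \<Rightarrow> bool" where
  "file_mapping P r m \<eta>1 S \<longleftrightarrow>
     num_files S = \<eta>1 * num_groups P r m \<and>
     indexed_partition (batch S) {1..num_groups P r m} {1..num_files S} \<and>
     (\<forall>l\<in>{1..num_groups P r m}. card (batch S l) = \<eta>1) \<and>
     (\<forall>k\<in>{1..num_nodes S}.
        stored S k = (\<Union>l\<in>{l\<in>{1..num_groups P r m}. k \<in> node_group S l}. batch S l))"

definition function_assignment ::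
  "nat \<Rightarrow> (nat \<Rightarrow> nat) \<Rightarrow> (nat \<Rightarrow> nat) \<Rightarrow> nat \<Rightarrow> 'b hypercuboid_scheme \<Rightarrow> bool" where
  "function_assignment P r m \<eta>2 S \<longleftrightarrow>
     real (num_funs S) =
       real \<eta>2 * real (lcm_pred P m) * (\<Sum>p=1..P. real (r p) * real (m p) / (real (m p) - 1)) \<and>
     indexed_partition (assigned S) {1..num_nodes S} {1..num_funs S} \<and>
     (\<forall>p\<in>{1..P}. \<forall>k\<in>node_class S p.
        real (card (assigned S k)) = real \<eta>2 * real (lcm_pred P m) / (real (m p) - 1))"


section \<open>The shuffle method\<close>

definition group_node :: "'b hypercuboid_scheme \<Rightarrow> nat \<Rightarrow> nat \<Rightarrow> nat" where
  "group_node S j i = the_elem (node_group S j \<inter> node_part S i)"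

definition neighbour_groups ::
  "nat \<Rightarrow> (nat \<Rightarrow> nat) \<Rightarrow> (nat \<Rightarrow> nat) \<Rightarrow> 'b hypercuboid_scheme \<Rightarrow> nat \<Rightarrow> nat \<Rightarrow> nat set" where
  "neighbour_groups P r m S z \<alpha> =
     {l\<in>{1..num_groups P r m}. \<exists>h\<in>{1..group_size P r}. z \<in> node_part S h \<and>
        group_node S l h \<noteq> z \<and>
        (\<forall>i\<in>{1..group_size P r} - {h}. group_node S l i = group_node S \<alpha> i)}"

definition requested_ivs ::
  "nat \<Rightarrow> (nat \<Rightarrow> nat) \<Rightarrow> (nat \<Rightarrow> nat) \<Rightarrow> 'b hypercuboid_scheme \<Rightarrow> nat \<Rightarrow> nat \<Rightarrow> (nat \<times> nat) set" where
  "requested_ivs P r m S z \<alpha> =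
     (\<Union>l\<in>neighbour_groups P r m S z \<alpha>. assigned S z \<times> batch S l)"

definition iv_string :: "'b hypercuboid_scheme \<Rightarrow> nat \<Rightarrow> nat \<Rightarrow> bool list" where
  "iv_string S z \<alpha> = concat (map (\<lambda>(i, j). iv S i j) (iv_order S z \<alpha>))"

definition iv_segment ::
  "nat \<Rightarrow> (nat \<Rightarrow> nat) \<Rightarrow> 'b hypercuboid_scheme \<Rightarrow> nat \<Rightarrow> nat \<Rightarrow> nat \<Rightarrow> bool list" where
  "iv_segment P r S z \<alpha> \<sigma> =
     (let s = iv_string S z \<alpha>; len = length s div (group_size P r - 1)
      in take len (drop (seg_pos S z \<alpha> \<sigma> * len) s))"

text \<open>
  Bitwise XOR of a finite nonempty family of bit strings. Shorter strings would be padded with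
  zeros to the length of the longest one; the length is not chosen by the scheme.
\<close>

definition xor_strings :: "('a \<Rightarrow> bool list) \<Rightarrow> 'a set \<Rightarrow> bool list" where
  "xor_strings f A =
     map (\<lambda>n. odd (card {a\<in>A. n < length (f a) \<and> f a ! n})) [0..<Max ((\<lambda>a. length (f a)) ` A)]"

definition coded_message ::
  "nat \<Rightarrow> (nat \<Rightarrow> nat) \<Rightarrow> 'b hypercuboid_scheme \<Rightarrow> nat \<Rightarrow> nat \<Rightarrow> bool list" where
  "coded_message P r S \<alpha> k =
     xor_strings (\<lambda>z. iv_segment P r S z \<alpha> k) (node_group S \<alpha> - {k})"

definition shuffle_setup ::
  "nat \<Rightarrow> (nat \<Rightarrow> nat) \<Rightarrow> (nat \<Rightarrow> nat) \<Rightarrow> 'b hypercuboid_scheme \<Rightarrow> bool" where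
  "shuffle_setup P r m S \<longleftrightarrow>
     (\<forall>\<alpha>\<in>{1..num_groups P r m}. \<forall>z\<in>node_group S \<alpha>.
        distinct (iv_order S z \<alpha>) \<and> set (iv_order S z \<alpha>) = requested_ivs P r m S z \<alpha> \<and>
        bij_betw (seg_pos S z \<alpha>) (node_group S \<alpha> - {z}) {0..<group_size P r - 1} \<and>
        (group_size P r - 1) dvd length (iv_string S z \<alpha>))"

definition coded_load ::
  "nat \<Rightarrow> (nat \<Rightarrow> nat) \<Rightarrow> (nat \<Rightarrow> nat) \<Rightarrow> 'b hypercuboid_scheme \<Rightarrow> real" where
  "coded_load P r m S =
     comm_load S (SIGMA \<alpha>:{1..num_groups P r m}. node_group S \<alpha>) (\<lambda>(\<alpha>, k). coded_message P r S \<alpha> k)"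

definition hypercuboid_cdc ::
  "nat \<Rightarrow> (nat \<Rightarrow> nat) \<Rightarrow> (nat \<Rightarrow> nat) \<Rightarrow> nat \<Rightarrow> nat \<Rightarrow> nat \<Rightarrow> 'b hypercuboid_scheme \<Rightarrow> bool" where
  "hypercuboid_cdc P r m \<eta>1 \<eta>2 T S \<longleftrightarrow>
     iv_len S = T \<and>
     (\<forall>i\<in>{1..num_funs S}. \<forall>j\<in>{1..num_files S}. length (iv S i j) = T) \<and>
     node_grouping P r m S \<and>
     file_mapping P r m \<eta>1 S \<and>
     function_assignment P r m \<eta>2 S \<and>
     shuffle_setup P r m S"

end

(*
  The exchanges of the node of K_h in a group T_alpha for another node of K_h number m_p - 1,
  which cancels the size of W_z: every node z of every group requests the same number
  eta_1 eta_2 Y of intermediate values. Hence all segments have equal length, and XORing the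
  segments of the other r - 1 nodes costs a fraction 1/(r - 1) of the requested bits per
  transmission. Conversely a group that avoids z is an exchange of exactly one group through z,
  so the sets requested by the pairs (z, alpha) with z in T_alpha partition all requests, and
  the uncoded load counts exactly the same bits, once each.
*)
theory Submission
  imports Defs
begin

section \<open>Index blocks, and lengths of XORs and segments\<close>

lemma disjoint_family_on_index_eq:
  assumes "disjoint_family_on A I" "i \<in> I" "j \<in> I" "x \<in> A i" "x \<in> A j"
  shows "i = j"
  using disjoint_family_onD[OF assms(1-3)] assms(4,5) by blast

text \<open>Block \<open>p\<close> begins one past the partial sum at which the preceding block
  ends, so each new block prolongs the interval without a gap.\<close>

lemma UN_part_indices: "(\<Union>p\<in>{1..P}. part_indices r p) = {1..group_size P r}"
proof (induction P)
  case (Suc P)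
  have "(\<Union>p\<in>{1..Suc P}. part_indices r p) = {1..group_size P r} \<union> part_indices r (Suc P)"
    using Suc by (simp add: atLeastAtMostSuc_conv Un_commute)
  also have "part_indices r (Suc P) = {group_size P r + 1..group_size (Suc P) r}"
    by (simp add: part_indices_def group_size_def atLeastLessThanSuc_atLeastAtMost)
  also have "{1..group_size P r} \<union> \<dots> = {1..group_size (Suc P) r}"
    by (auto simp: group_size_def)
  finally show ?case .
qed (simp add: group_size_def)

text \<open>Equal lengths make the maximum in \<open>xor_strings\<close> equal to \<open>n\<close>,
  so no zero padding occurs; nonemptiness of \<open>A\<close> ensures that \<open>Max\<close> is
  taken over \<open>{n}\<close>.\<close>

lemma length_xor_strings:
  assumes "A \<noteq> {}" and "\<And>a. a \<in> A \<Longrightarrow> length (f a) = n"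
  shows "length (xor_strings f A) = n"
proof -
  have "(\<lambda>a. length (f a)) ` A = {n}"
    using assms by auto
  then show ?thesis
    by (simp add: xor_strings_def)
qed

lemma length_segment:
  fixes n :: nat
  assumes "n dvd length s" and "q < n"
  shows "length (take (length s div n) (drop (q * (length s div n)) s)) = length s div n"
proof -
  let ?d = "length s div n"
  \<comment> \<open>Segment \<open>q\<close> ends at position \<open>(q + 1) * ?d\<close>; once this
    lies inside the string, \<open>take\<close> is not cut short.\<close>
  have "(q + 1) * ?d \<le> n * ?d"
    using assms(2) by (intro mult_right_mono) auto
  also have "\<dots> = length s"
    using assms(1) by simp
  finally show ?thesis
    by simp
qed

text \<open>Allows \<open>Y\<close> to be cancelled in the loads: a finite \<open>Lcm\<close> of
  naturals vanishes only if 0 is among its arguments, and \<open>m p \<ge> 2\<close> excludes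
  that.\<close>

lemma lcm_pred_pos:
  assumes "\<And>p. p \<in> {1..P} \<Longrightarrow> m p \<ge> 2"
  shows "lcm_pred P m > 0"
proof -
  have "0 \<notin> (\<lambda>p. m p - 1) ` {1..P}"
    using assms by force
  then have "lcm_pred P m \<noteq> 0"
    unfolding lcm_pred_def by (subst Lcm_0_iff) auto
  then show ?thesis
    by simp
qed

section \<open>A fixed instance of the scheme and its partition of the nodes\<close>

locale hypercuboid_system =
  fixes P \<eta>1 \<eta>2 T :: nat and r m :: "nat \<Rightarrow> nat" and S :: "'b hypercuboid_scheme"
  assumes m_ge_2: "p \<in> {1..P} \<Longrightarrow> m p \<ge> 2"
    and group_size_ge_2: "group_size P r \<ge> 2"
    and cdc: "hypercuboid_cdc P r m \<eta>1 \<eta>2 T S"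
begin

abbreviation "R \<equiv> group_size P r"
abbreviation "X \<equiv> num_groups P r m"
abbreviation "Y \<equiv> lcm_pred P m"
abbreviation "requested \<equiv> requested_ivs P r m S"
abbreviation "neighbours \<equiv> neighbour_groups P r m S"

lemma grouping: "node_grouping P r m S"
  and mapping: "file_mapping P r m \<eta>1 S"
  and assignment: "function_assignment P r m \<eta>2 S"
  and shuffling: "shuffle_setup P r m S"
  and iv_len_eq: "iv_len S = T"
  and length_iv: "\<lbrakk>i \<in> {1..num_funs S}; j \<in> {1..num_files S}\<rbrakk> \<Longrightarrow> length (iv S i j) = T"
  using cdc by (auto simp: hypercuboid_cdc_def)

text \<open>The grouping conditions are given class by class, whereas node groups use one global
  index \<open>h\<close>; this supplies the class that \<open>h\<close> belongs to.\<close>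

lemma part_class:
  assumes "h \<in> {1..R}"
  obtains p where "p \<in> {1..P}" "h \<in> part_indices r p" "node_part S h \<subseteq> node_class S p"
    "card (node_part S h) = m p"
proof -
  obtain p where p: "p \<in> {1..P}" "h \<in> part_indices r p"
    using assms UN_part_indices[of r P] by blast
  have "(\<Union>i\<in>part_indices r p. node_part S i) = node_class S p" "card (node_part S h) = m p"
    using grouping p by (simp_all add: node_grouping_def indexed_partition_def)
  then show ?thesis
    using that[OF p] p(2) by blast
qed

text \<open>The partition has two levels: a common node first forces equal classes, and inside one
  class the parts are disjoint.\<close>

lemma node_part_disjoint:
  assumes "h \<in> {1..R}" "i \<in> {1..R}" "z \<in> node_part S h" "z \<in> node_part S i"
  shows "h = i"
proof (rule ccontr)
  assume "h \<noteq> i"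
  obtain p where p: "p \<in> {1..P}" "h \<in> part_indices r p" "node_part S h \<subseteq> node_class S p"
    using part_class[OF assms(1)] by blast
  obtain q where q: "q \<in> {1..P}" "i \<in> part_indices r q" "node_part S i \<subseteq> node_class S q"
    using part_class[OF assms(2)] by blast
  have "disjoint_family_on (node_class S) {1..P}"
    using grouping by (simp add: node_grouping_def indexed_partition_def)
  then have "p = q"
    using disjoint_family_on_index_eq p q assms(3,4) by (metis subsetD)
  moreover have "disjoint_family_on (node_part S) (part_indices r p)"
    using grouping p(1) by (simp add: node_grouping_def indexed_partition_def)
  ultimately show False
    using disjoint_family_on_index_eq p q assms(3,4) \<open>h \<noteq> i\<close> by metis
qed

lemma UN_node_part: "(\<Union>h\<in>{1..R}. node_part S h) = {1..num_nodes S}"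
proof -
  have "(\<Union>h\<in>{1..R}. node_part S h) = (\<Union>p\<in>{1..P}. \<Union>h\<in>part_indices r p. node_part S h)"
    by (subst UN_part_indices[symmetric]) blast
  also have "\<dots> = (\<Union>p\<in>{1..P}. node_class S p)"
    using grouping by (intro SUP_cong) (auto simp: node_grouping_def indexed_partition_def)
  also have "\<dots> = {1..num_nodes S}"
    using grouping by (simp add: node_grouping_def indexed_partition_def)
  finally show ?thesis .
qed

section \<open>Node groups as points of a grid, with one coordinate per part\<close>

lemma node_group_mem: "\<alpha> \<in> {1..X} \<Longrightarrow> node_group S \<alpha> \<in> all_node_groups P r S"
  using grouping by (auto simp: node_grouping_def bij_betw_def)

lemma card_node_group: "\<alpha> \<in> {1..X} \<Longrightarrow> card (node_group S \<alpha>) = R"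
  using node_group_mem by (auto simp: all_node_groups_def)

lemma node_group_subset: "\<alpha> \<in> {1..X} \<Longrightarrow> node_group S \<alpha> \<subseteq> {1..num_nodes S}"
  using node_group_mem by (auto simp: all_node_groups_def)

lemma node_group_Int:
  assumes "\<alpha> \<in> {1..X}" "h \<in> {1..R}"
  shows "node_group S \<alpha> \<inter> node_part S h = {group_node S \<alpha> h}"
proof -
  have "card (node_group S \<alpha> \<inter> node_part S h) = 1"
    using node_group_mem[OF assms(1)] assms(2) by (simp add: all_node_groups_def)
  then obtain x where "node_group S \<alpha> \<inter> node_part S h = {x}"
    by (auto simp: card_1_singleton_iff)
  then show ?thesis
    by (simp add: group_node_def)
qed

text \<open>Turns membership into an equation for \<open>group_node S \<alpha> h\<close>, the
  \<open>h\<close>-th coordinate of group \<open>\<alpha>\<close>.\<close>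

lemma mem_node_group_iff:
  assumes "\<alpha> \<in> {1..X}" "h \<in> {1..R}" "z \<in> node_part S h"
  shows "z \<in> node_group S \<alpha> \<longleftrightarrow> group_node S \<alpha> h = z"
proof -
  have "z \<in> node_group S \<alpha> \<longleftrightarrow> z \<in> node_group S \<alpha> \<inter> node_part S h"
    using assms(3) by simp
  then show ?thesis
    unfolding node_group_Int[OF assms(1,2)] by auto
qed

lemma group_node_part: "\<lbrakk>\<alpha> \<in> {1..X}; h \<in> {1..R}\<rbrakk> \<Longrightarrow> group_node S \<alpha> h \<in> node_part S h"
  using node_group_Int[of \<alpha> h] by auto

text \<open>The parts cover all nodes, so the coordinates determine the node set; the enumeration of
  groups is injective, so the set determines the index.\<close>

lemma group_eqI:
  assumes "\<alpha> \<in> {1..X}" "\<beta> \<in> {1..X}" "\<And>h. h \<in> {1..R} \<Longrightarrow> group_node S \<alpha> h = group_node S \<beta> h"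
  shows "\<alpha> = \<beta>"
proof -
  have "node_group S \<alpha> = node_group S \<beta>"
  proof (rule set_eqI)
    fix z
    show "z \<in> node_group S \<alpha> \<longleftrightarrow> z \<in> node_group S \<beta>"
    proof (cases "z \<in> (\<Union>h\<in>{1..R}. node_part S h)")
      case True
      then obtain h where h: "h \<in> {1..R}" "z \<in> node_part S h"
        by blast
      show ?thesis
        unfolding mem_node_group_iff[OF assms(1) h] mem_node_group_iff[OF assms(2) h] assms(3)[OF h(1)] ..
    next
      case False
      then show ?thesis
        using node_group_subset assms(1,2) unfolding UN_node_part by blast
    qed
  qed
  moreover have "inj_on (node_group S) {1..X}"
    using grouping by (simp add: node_grouping_def bij_betw_def)
  ultimately show ?thesis
    using assms(1,2) by (meson inj_onD)
qed

text \<open>Disjointness of the parts makes the chosen nodes distinct, one in each part, so they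
  form a node group, and the enumeration reaches it. With \<open>group_eqI\<close>, groups
  correspond to the points of the product of the parts.\<close>

lemma group_of_choice:
  assumes f: "\<And>h. h \<in> {1..R} \<Longrightarrow> f h \<in> node_part S h"
  obtains \<alpha> where "\<alpha> \<in> {1..X}" "\<And>h. h \<in> {1..R} \<Longrightarrow> group_node S \<alpha> h = f h"
proof -
  have "inj_on f {1..R}"
    using f node_part_disjoint by (metis inj_onI)
  then have "card (f ` {1..R}) = R"
    by (simp add: card_image)
  moreover have Int: "f ` {1..R} \<inter> node_part S h = {f h}" if "h \<in> {1..R}" for h
    using that f node_part_disjoint by blast
  moreover have "f ` {1..R} \<subseteq> {1..num_nodes S}"
    using f UN_node_part by blast
  ultimately have "f ` {1..R} \<in> all_node_groups P r S"
    by (simp add: all_node_groups_def)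
  moreover have "node_group S ` {1..X} = all_node_groups P r S"
    using grouping by (simp add: node_grouping_def bij_betw_def)
  ultimately obtain \<alpha> where \<alpha>: "\<alpha> \<in> {1..X}" "node_group S \<alpha> = f ` {1..R}"
    by (metis imageE)
  then show ?thesis
    using that Int by (simp add: group_node_def)
qed

section \<open>Exchanging one node, and counting the neighbouring groups\<close>

lemma exchange:
  assumes "\<alpha> \<in> {1..X}" "h \<in> {1..R}" "z \<in> node_part S h"
  obtains l where "l \<in> {1..X}" "group_node S l h = z"
    "\<And>i. i \<in> {1..R} - {h} \<Longrightarrow> group_node S l i = group_node S \<alpha> i"
proof -
  have "((group_node S \<alpha>)(h := z)) i \<in> node_part S i" if "i \<in> {1..R}" for i
    using that assms group_node_part by auto
  then obtain l where "l \<in> {1..X}"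
    "\<And>i. i \<in> {1..R} \<Longrightarrow> group_node S l i = ((group_node S \<alpha>)(h := z)) i"
    using group_of_choice by blast
  then show ?thesis
    using that[of l] assms(2) by simp
qed

text \<open>\<open>z\<close> lies in a single part, so the existential \<open>h\<close> in
  \<open>neighbour_groups\<close> can only be the given one.\<close>

lemma neighbours_eq:
  assumes "h \<in> {1..R}" "z \<in> node_part S h"
  shows "neighbours z \<alpha> = {l \<in> {1..X}. group_node S l h \<noteq> z \<and>
    (\<forall>i\<in>{1..R} - {h}. group_node S l i = group_node S \<alpha> i)}"
proof -
  have "i = h" if "i \<in> {1..R}" "z \<in> node_part S i" for i
    using node_part_disjoint that assms by blast
  then show ?thesis
    using assms unfolding neighbour_groups_def by blast
qed

text \<open>A neighbour is free only in coordinate \<open>h\<close>, where it may take any node of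
  the part other than \<open>z\<close>; reading off this coordinate is the bijection.\<close>

lemma card_neighbours:
  assumes "\<alpha> \<in> {1..X}" "h \<in> {1..R}" "z \<in> node_part S h"
  shows "card (neighbours z \<alpha>) = card (node_part S h) - 1"
proof -
  have "bij_betw (\<lambda>l. group_node S l h) (neighbours z \<alpha>) (node_part S h - {z})"
  proof (rule bij_betw_imageI)
    show "inj_on (\<lambda>l. group_node S l h) (neighbours z \<alpha>)"
    proof (rule inj_onI)
      fix l l' assume l: "l \<in> neighbours z \<alpha>" "l' \<in> neighbours z \<alpha>"
        and eq: "group_node S l h = group_node S l' h"
      show "l = l'"
      proof (rule group_eqI)
        fix i assume "i \<in> {1..R}"
        then show "group_node S l i = group_node S l' i"
          using l eq unfolding neighbours_eq[OF assms(2,3)] by (cases "i = h") simp_all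
      qed (use l in \<open>auto simp: neighbour_groups_def\<close>)
    qed
    show "(\<lambda>l. group_node S l h) ` neighbours z \<alpha> = node_part S h - {z}"
    proof (intro equalityI subsetI)
      fix x assume "x \<in> node_part S h - {z}"
      then have x: "x \<in> node_part S h" "x \<noteq> z"
        by auto
      obtain l where "l \<in> {1..X}" "group_node S l h = x"
        "\<And>i. i \<in> {1..R} - {h} \<Longrightarrow> group_node S l i = group_node S \<alpha> i"
        using exchange[OF assms(1,2) x(1)] by blast
      then show "x \<in> (\<lambda>l. group_node S l h) ` neighbours z \<alpha>"
        unfolding neighbours_eq[OF assms(2,3)] using x(2) by blast
    qed (use assms group_node_part neighbours_eq[OF assms(2,3)] in auto)
  qed
  then show ?thesis
    using assms(3) by (simp add: bij_betw_same_card)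
qed

section \<open>Batches, and the intermediate values requested in a group\<close>

lemma batch_disjoint:
  "\<lbrakk>l \<in> {1..X}; l' \<in> {1..X}; j \<in> batch S l; j \<in> batch S l'\<rbrakk> \<Longrightarrow> l = l'"
  by (rule disjoint_family_on_index_eq[of "batch S" "{1..X}"])
    (use mapping in \<open>simp_all add: file_mapping_def indexed_partition_def\<close>)

lemma UN_batch: "(\<Union>l\<in>{1..X}. batch S l) = {1..num_files S}"
  using mapping by (simp add: file_mapping_def indexed_partition_def)

text \<open>A file lies in one batch only, so among the batches stored at \<open>z\<close> only
  batch \<open>l\<close> can supply it.\<close>

lemma mem_stored_iff:
  assumes "z \<in> {1..num_nodes S}" "l \<in> {1..X}" "j \<in> batch S l"
  shows "j \<in> stored S z \<longleftrightarrow> z \<in> node_group S l"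
proof -
  have "stored S z = (\<Union>l\<in>{l\<in>{1..X}. z \<in> node_group S l}. batch S l)"
    using mapping assms(1) by (simp add: file_mapping_def)
  then show ?thesis
    using assms(2,3) batch_disjoint by blast
qed

lemma assigned_subset: "z \<in> {1..num_nodes S} \<Longrightarrow> assigned S z \<subseteq> {1..num_funs S}"
  using assignment unfolding function_assignment_def indexed_partition_def by blast

lemma requested_subset:
  assumes "z \<in> {1..num_nodes S}"
  shows "requested z \<alpha> \<subseteq> {1..num_funs S} \<times> {1..num_files S}"
proof -
  have "neighbours z \<alpha> \<subseteq> {1..X}"
    by (auto simp: neighbour_groups_def)
  then have "requested z \<alpha> \<subseteq> assigned S z \<times> (\<Union>l\<in>{1..X}. batch S l)"
    unfolding requested_ivs_def by blast
  then show ?thesis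
    using assigned_subset[OF assms] unfolding UN_batch by blast
qed

lemma finite_requested: "z \<in> {1..num_nodes S} \<Longrightarrow> finite (requested z \<alpha>)"
  by (rule finite_subset[OF requested_subset]) auto

lemma node_part_exists:
  assumes "z \<in> {1..num_nodes S}"
  obtains h where "h \<in> {1..R}" "z \<in> node_part S h"
  using assms UN_node_part by blast

lemma card_requested:
  assumes "\<alpha> \<in> {1..X}" "z \<in> node_group S \<alpha>"
  shows "card (requested z \<alpha>) = \<eta>1 * \<eta>2 * Y"
proof -
  have z: "z \<in> {1..num_nodes S}"
    using assms node_group_subset by blast
  then obtain h where h: "h \<in> {1..R}" "z \<in> node_part S h"
    by (rule node_part_exists)
  obtain p where p: "p \<in> {1..P}" "node_part S h \<subseteq> node_class S p" "card (node_part S h) = m p"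
    using part_class[OF h(1)] by blast
  have sub: "neighbours z \<alpha> \<subseteq> {1..X}"
    by (auto simp: neighbour_groups_def)
  have "card (\<Union>l\<in>neighbours z \<alpha>. batch S l) = (\<Sum>l\<in>neighbours z \<alpha>. card (batch S l))"
  proof (rule card_UN_disjoint)
    show "finite (neighbours z \<alpha>)"
      using sub finite_subset by blast
    show "\<forall>l\<in>neighbours z \<alpha>. finite (batch S l)"
      using sub UN_batch by (metis UN_upper finite_atLeastAtMost finite_subset subsetD)
    show "\<forall>l\<in>neighbours z \<alpha>. \<forall>l'\<in>neighbours z \<alpha>. l \<noteq> l' \<longrightarrow> batch S l \<inter> batch S l' = {}"
      using sub batch_disjoint by blast
  qed
  also have "\<dots> = (\<Sum>l\<in>neighbours z \<alpha>. \<eta>1)"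
    using sub mapping by (intro sum.cong) (auto simp: file_mapping_def)
  also have "\<dots> = (m p - 1) * \<eta>1"
    using card_neighbours[OF assms(1) h] p(3) by simp
  finally have files: "card (\<Union>l\<in>neighbours z \<alpha>. batch S l) = (m p - 1) * \<eta>1" .
  \<comment> \<open>All neighbours contribute the same functions, so the union of products is a
    single product.\<close>
  have "requested z \<alpha> = assigned S z \<times> (\<Union>l\<in>neighbours z \<alpha>. batch S l)"
    by (auto simp: requested_ivs_def)
  then have "card (requested z \<alpha>) = card (assigned S z) * ((m p - 1) * \<eta>1)"
    using files by (simp add: card_cartesian_product)
  moreover have "real (card (assigned S z)) = real \<eta>2 * real Y / (real (m p) - 1)"
    using assignment p h(2) by (auto simp: function_assignment_def)
  \<comment> \<open>The size of \<open>assigned S z\<close> is known as a real quotient, so the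
    cancellation takes place in the reals; \<open>m p \<ge> 2\<close> makes truncated subtraction
    exact and the denominator positive.\<close>
  moreover have "real (m p - 1) = real (m p) - 1" "real (m p) - 1 > 0"
    using m_ge_2[OF p(1)] by auto
  ultimately have "real (card (requested z \<alpha>)) = real (\<eta>1 * \<eta>2 * Y)"
    by simp
  then show ?thesis
    using of_nat_eq_iff by blast
qed

section \<open>Bits sent by the coded shuffle\<close>

lemma length_iv_string:
  assumes "\<alpha> \<in> {1..X}" "z \<in> node_group S \<alpha>"
  shows "length (iv_string S z \<alpha>) = \<eta>1 * \<eta>2 * Y * T"
proof -
  have z: "z \<in> {1..num_nodes S}"
    using assms node_group_subset by blast
  have order: "distinct (iv_order S z \<alpha>)" "set (iv_order S z \<alpha>) = requested z \<alpha>"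
    using shuffling assms by (auto simp: shuffle_setup_def)
  have "length (iv_string S z \<alpha>) = (\<Sum>(i, j)\<leftarrow>iv_order S z \<alpha>. length (iv S i j))"
    by (simp add: iv_string_def length_concat comp_def split_def)
  \<comment> \<open>Distinctness of the list counts every requested pair once, and the order of
    concatenation drops out.\<close>
  also have "\<dots> = (\<Sum>(i, j)\<in>requested z \<alpha>. length (iv S i j))"
    using order by (simp add: sum_list_distinct_conv_sum_set)
  also have "\<dots> = (\<Sum>_\<in>requested z \<alpha>. T)"
    using requested_subset[OF z, of \<alpha>] by (intro sum.cong) (auto intro!: length_iv)
  also have "\<dots> = \<eta>1 * \<eta>2 * Y * T"
    using card_requested[OF assms] by simp
  finally show ?thesis .
qed

text \<open>\<open>shuffle_setup\<close> gives divisibility for each single string; all strings have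
  the same length, so any member of the group transfers it to the common value. A member exists
  because \<open>R \<ge> 2\<close>.\<close>

lemma group_size_dvd:
  assumes "\<alpha> \<in> {1..X}"
  shows "(R - 1) dvd \<eta>1 * \<eta>2 * Y * T"
proof -
  obtain z where "z \<in> node_group S \<alpha>"
    using card_node_group[OF assms] group_size_ge_2 by fastforce
  then show ?thesis
    using shuffling assms length_iv_string[OF assms] unfolding shuffle_setup_def by metis
qed

lemma length_coded_message:
  assumes "\<alpha> \<in> {1..X}" "k \<in> node_group S \<alpha>"
  shows "length (coded_message P r S \<alpha> k) = \<eta>1 * \<eta>2 * Y * T div (R - 1)"
  unfolding coded_message_def
proof (rule length_xor_strings)
  have "card (node_group S \<alpha> - {k}) > 0"
    using card_node_group[OF assms(1)] assms(2) group_size_ge_2 by (simp add: card_Diff_singleton)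
  then show "node_group S \<alpha> - {k} \<noteq> {}"
    by (metis card.empty less_irrefl)
next
  fix z assume z: "z \<in> node_group S \<alpha> - {k}"
  then have "bij_betw (seg_pos S z \<alpha>) (node_group S \<alpha> - {z}) {0..<R - 1}"
    using shuffling assms(1) by (auto simp: shuffle_setup_def)
  \<comment> \<open>\<open>k\<close> lies in the group and differs from \<open>z\<close>, so it
    labels one of the positions \<open>0\<close> to \<open>R - 2\<close>, as
    \<open>length_segment\<close> demands.\<close>
  then have "seg_pos S z \<alpha> k < R - 1"
    using z assms(2) by (auto dest: bij_betwE)
  moreover have "(R - 1) dvd length (iv_string S z \<alpha>)"
    using z assms(1) group_size_dvd length_iv_string by simp
  ultimately show "length (iv_segment P r S z \<alpha> k) = \<eta>1 * \<eta>2 * Y * T div (R - 1)"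
    unfolding iv_segment_def Let_def
    using z assms(1) length_iv_string by (subst length_segment) auto
qed

lemma finite_node_group: "\<alpha> \<in> {1..X} \<Longrightarrow> finite (node_group S \<alpha>)"
  by (rule finite_subset[OF node_group_subset]) auto

text \<open>The factor \<open>R - 1\<close> stands on the left so that the count contains no
  quotient: each of the \<open>X * R\<close> messages has a length divided by \<open>R - 1\<close>,
  exactly so by \<open>group_size_dvd\<close>.\<close>

lemma coded_bits:
  "(R - 1) * (\<Sum>(\<alpha>, k)\<in>(SIGMA \<alpha>:{1..X}. node_group S \<alpha>). length (coded_message P r S \<alpha> k))
     = X * R * (\<eta>1 * \<eta>2 * Y * T)"
proof -
  have "(\<Sum>(\<alpha>, k)\<in>(SIGMA \<alpha>:{1..X}. node_group S \<alpha>). length (coded_message P r S \<alpha> k))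
      = (\<Sum>\<alpha>\<in>{1..X}. \<Sum>k\<in>node_group S \<alpha>. length (coded_message P r S \<alpha> k))"
    using finite_node_group by (simp add: sum.Sigma)
  also have "(R - 1) * \<dots> = (\<Sum>\<alpha>\<in>{1..X}. \<Sum>k\<in>node_group S \<alpha>. \<eta>1 * \<eta>2 * Y * T)"
    unfolding sum_distrib_left
    using length_coded_message group_size_dvd by (intro sum.cong) auto
  also have "\<dots> = X * R * (\<eta>1 * \<eta>2 * Y * T)"
    using card_node_group by simp
  finally show ?thesis .
qed

section \<open>Bits sent by the uncoded shuffle\<close>

text \<open>The map forgets the group, which the request determines: its coordinate in the part of
  \<open>z\<close> is \<open>z\<close>, and the others are those of the group whose batch contains
  \<open>j\<close>.\<close>

lemma requests_bij:
  "bij_betw (\<lambda>((\<alpha>, z), (i, j)). (z, i, j))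
     (SIGMA (\<alpha>, z):(SIGMA \<alpha>:{1..X}. node_group S \<alpha>). requested z \<alpha>) (requests S)"
  (is "bij_betw ?f ?A _")
proof (rule bij_betw_imageI)
  show "inj_on ?f ?A"
  proof (rule inj_onI, clarsimp)
    fix \<alpha> \<beta> z i j
    assume *: "Suc 0 \<le> \<alpha>" "\<alpha> \<le> X" "z \<in> node_group S \<alpha>" "(i, j) \<in> requested z \<alpha>"
      "Suc 0 \<le> \<beta>" "\<beta> \<le> X" "z \<in> node_group S \<beta>" "(i, j) \<in> requested z \<beta>"
    then have \<alpha>\<beta>: "\<alpha> \<in> {1..X}" "\<beta> \<in> {1..X}"
      by auto
    have "z \<in> {1..num_nodes S}"
      using * \<alpha>\<beta> node_group_subset by blast
    then obtain h where h: "h \<in> {1..R}" "z \<in> node_part S h"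
      by (rule node_part_exists)
    obtain l l' where l: "l \<in> neighbours z \<alpha>" "j \<in> batch S l" "l' \<in> neighbours z \<beta>" "j \<in> batch S l'"
      using * by (auto simp: requested_ivs_def)
    then have "l' = l"
      by (intro batch_disjoint[of l' l j]) (auto simp: neighbour_groups_def)
    show "\<alpha> = \<beta>"
    proof (rule group_eqI[OF \<alpha>\<beta>])
      fix i assume "i \<in> {1..R}"
      show "group_node S \<alpha> i = group_node S \<beta> i"
      proof (cases "i = h")
        case True
        then show ?thesis
          using mem_node_group_iff[OF \<alpha>\<beta>(1) h] mem_node_group_iff[OF \<alpha>\<beta>(2) h] *(3,7)
          by simp
      next
        case False
        then show ?thesis
          using l(1,3) \<open>l' = l\<close> \<open>i \<in> {1..R}\<close> unfolding neighbours_eq[OF h] by simp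
      qed
    qed
  qed
  show "?f ` ?A = requests S"
  proof (intro equalityI subsetI)
    fix x assume "x \<in> ?f ` ?A"
    then obtain \<alpha> z i j where x: "x = (z, i, j)" "\<alpha> \<in> {1..X}" "z \<in> node_group S \<alpha>"
      "(i, j) \<in> requested z \<alpha>"
      by auto
    then have z: "z \<in> {1..num_nodes S}"
      using node_group_subset by blast
    then obtain h where h: "h \<in> {1..R}" "z \<in> node_part S h"
      by (rule node_part_exists)
    obtain l where l: "l \<in> neighbours z \<alpha>" "j \<in> batch S l" "i \<in> assigned S z"
      using x by (auto simp: requested_ivs_def)
    \<comment> \<open>Coordinate \<open>h\<close> of group \<open>l\<close> is not \<open>z\<close>,
      so the group misses \<open>z\<close> and its batch is not stored there.\<close>
    then have "l \<in> {1..X}" "z \<notin> node_group S l"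
      using mem_node_group_iff[OF _ h] by (auto simp: neighbours_eq[OF h])
    then have "j \<notin> stored S z"
      using mem_stored_iff[OF z _ l(2)] by blast
    moreover have "j \<in> {1..num_files S}"
      using requested_subset[OF z] x(4) by blast
    ultimately show "x \<in> requests S"
      using x(1) l(3) z by (simp add: requests_def)
  next
    fix x assume "x \<in> requests S"
    then obtain z i j where x: "x = (z, i, j)" and z: "z \<in> {1..num_nodes S}"
      and i: "i \<in> assigned S z" and j: "j \<in> {1..num_files S}" "j \<notin> stored S z"
      by (auto simp: requests_def)
    obtain l where l: "l \<in> {1..X}" "j \<in> batch S l"
      using j UN_batch by blast
    obtain h where h: "h \<in> {1..R}" "z \<in> node_part S h"
      using node_part_exists[OF z] .
    \<comment> \<open>Group \<open>l\<close> of the batch containing \<open>j\<close> misses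
      \<open>z\<close>; putting \<open>z\<close> into its coordinate \<open>h\<close> gives the
      group \<open>\<alpha>\<close> that serves the request.\<close>
    have "group_node S l h \<noteq> z"
      using mem_stored_iff[OF z l] j mem_node_group_iff[OF l(1) h] by simp
    moreover obtain \<alpha> where \<alpha>: "\<alpha> \<in> {1..X}" "group_node S \<alpha> h = z"
      "\<And>i. i \<in> {1..R} - {h} \<Longrightarrow> group_node S \<alpha> i = group_node S l i"
      using exchange[OF l(1) h] by blast
    ultimately have "l \<in> neighbours z \<alpha>"
      using l(1) by (simp add: neighbours_eq[OF h])
    then have "(i, j) \<in> requested z \<alpha>"
      using i l(2) by (auto simp: requested_ivs_def)
    moreover have "z \<in> node_group S \<alpha>"
      using mem_node_group_iff[OF \<alpha>(1) h] \<alpha>(2) by simp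
    ultimately have "((\<alpha>, z), (i, j)) \<in> ?A"
      using \<alpha>(1) by auto
    then show "x \<in> ?f ` ?A"
      unfolding x by force
  qed
qed

text \<open>The total agrees with that of \<open>coded_bits\<close>, where it is reached after
  multiplication by \<open>R - 1\<close>; the ratio of the loads comes from this.\<close>

lemma uncoded_bits: "(\<Sum>(k, i, j)\<in>requests S. length (iv S i j)) = X * R * (\<eta>1 * \<eta>2 * Y * T)"
proof -
  let ?G = "SIGMA \<alpha>:{1..X}. node_group S \<alpha>"
  have "(\<Sum>(k, i, j)\<in>requests S. length (iv S i j)) = (\<Sum>_\<in>requests S. T)"
  proof (intro sum.cong, simp, clarify)
    fix k i j assume "(k, i, j) \<in> requests S"
    then show "length (iv S i j) = T"
      using assigned_subset[of k] by (intro length_iv) (auto simp: requests_def)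
  qed
  also have "\<dots> = card (requests S) * T"
    by simp
  also have "card (requests S) = card (SIGMA (\<alpha>, z):?G. requested z \<alpha>)"
    using bij_betw_same_card[OF requests_bij] by (rule sym)
  also have "\<dots> = (\<Sum>(\<alpha>, z)\<in>?G. card (requested z \<alpha>))"
  proof (subst card_SigmaI)
    show "finite ?G"
      using finite_node_group by blast
    show "\<forall>a\<in>?G. finite (case a of (\<alpha>, z) \<Rightarrow> requested z \<alpha>)"
    proof clarify
      fix \<alpha> z assume "\<alpha> \<in> {1..X}" "z \<in> node_group S \<alpha>"
      then show "finite (requested z \<alpha>)"
        using finite_requested node_group_subset by blast
    qed
  qed (simp add: case_prod_beta)
  also have "\<dots> = (\<Sum>_\<in>?G. \<eta>1 * \<eta>2 * Y)"
    using card_requested by (intro sum.cong) auto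
  also have "\<dots> = X * R * (\<eta>1 * \<eta>2 * Y)"
    using finite_node_group card_node_group by simp
  finally show ?thesis
    by (simp add: mult.assoc)
qed

end

section \<open>From bit counts to loads\<close>

theorem theorem3:
  fixes P \<eta>1 \<eta>2 T :: nat and r m :: "nat \<Rightarrow> nat" and S :: hypercuboid
  assumes "P \<ge> 1"
    and "\<And>p. p \<in> {1..P} \<Longrightarrow> r p \<ge> 1"
    and "\<And>p. p \<in> {1..P} \<Longrightarrow> m p \<ge> 2"
    and "\<eta>1 \<ge> 1" and "\<eta>2 \<ge> 1" and "T \<ge> 1"
    and "(\<Sum>p=1..P. r p) \<ge> 2"
    and "hypercuboid_cdc P r m \<eta>1 \<eta>2 T S"
  shows "coded_load P r m S =
           1 / ((\<Sum>p=1..P. real (r p)) - 1) *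
             ((\<Sum>p=1..P. real (r p)) / (\<Sum>p=1..P. real (r p) * real (m p) / (real (m p) - 1)))
       \<and> 1 / ((\<Sum>p=1..P. real (r p)) - 1) *
             ((\<Sum>p=1..P. real (r p)) / (\<Sum>p=1..P. real (r p) * real (m p) / (real (m p) - 1)))
         = 1 / ((\<Sum>p=1..P. real (r p)) - 1) * uncoded_load S"
proof -
  have R: "group_size P r \<ge> 2"
    using assms(7) by (simp add: group_size_def)
  interpret hypercuboid_system P \<eta>1 \<eta>2 T r m S
    using assms R by unfold_locales auto
  define D where "D = (\<Sum>p=1..P. real (r p) * real (m p) / (real (m p) - 1))"
  have "D > 0"
    unfolding D_def
  proof (rule sum_pos)
    fix p assume "p \<in> {1..P}"
    then show "real (r p) * real (m p) / (real (m p) - 1) > 0"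
      using assms(2,3)[of p] by (intro divide_pos_pos mult_pos_pos) auto
  qed (use assms(1) in auto)
  have "X > 0"
    unfolding num_groups_def using assms(3) by (intro prod_pos) fastforce
  have "Y > 0"
    using assms(3) by (rule lcm_pred_pos)
  have R_eq: "(\<Sum>p=1..P. real (r p)) = real R"
    by (simp add: group_size_def)
  have "num_files S = \<eta>1 * X"
    using mapping by (simp add: file_mapping_def)
  moreover have "real (num_funs S) = real \<eta>2 * real Y * D"
    using assignment by (simp add: function_assignment_def D_def)
  \<comment> \<open>The normaliser repeats every factor of the bit count except \<open>R\<close> and
    brings in \<open>D\<close>, so the count divided by it is \<open>R / D\<close>.\<close>
  ultimately have "real (num_funs S) * real (num_files S) * real (iv_len S)
      = real X * real (\<eta>1 * \<eta>2 * Y * T) * D" (is "?q = _")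
    using iv_len_eq by (simp add: mult_ac)
  note bits = this \<open>D > 0\<close> \<open>X > 0\<close> \<open>Y > 0\<close> assms(4-6) R
  have "uncoded_load S = real (X * R * (\<eta>1 * \<eta>2 * Y * T)) / ?q"
    unfolding uncoded_load_def comm_load_def uncoded_bits[symmetric]
    by (simp add: case_prod_beta)
  also have "\<dots> = real R / D"
    unfolding bits(1) using bits by (simp add: field_simps)
  finally have uncoded: "uncoded_load S = real R / D" .
  \<comment> \<open>\<open>R \<ge> 2\<close> lets the natural factor \<open>R - 1\<close> of
    \<open>coded_bits\<close> be read as \<open>real R - 1\<close>.\<close>
  have "(real R - 1) * coded_load P r m S = real (X * R * (\<eta>1 * \<eta>2 * Y * T)) / ?q"
    unfolding coded_load_def comm_load_def coded_bits[symmetric]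
    using R by (simp add: case_prod_beta)
  also have "\<dots> = real R / D"
    unfolding bits(1) using bits by (simp add: field_simps)
  finally have "(real R - 1) * coded_load P r m S = real R / D" .
  moreover have "real R - 1 \<noteq> 0"
    using R by simp
  ultimately have "coded_load P r m S = 1 / (real R - 1) * (real R / D)"
    by (metis nonzero_mult_div_cancel_left times_divide_eq_left mult_1)
  then show ?thesis
    unfolding R_eq D_def[symmetric] uncoded by simp
qed

end
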